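(* Let $G$ be a finite-dimensional Lie group with Lie algebra $\mathfrak{g}$, let $l_d\colon G\to\mathbb{R}$ be a smooth function, let $\varphi_d\colon G\to G$ be an arbitrary map, and let $\{w_k\}_{k=0}^{N-1}$ be a sequence of elements of $G$. Define the discrete momenta $M_k=\mathcal{R}^*_{w_k}dl_d(w_k)\in\mathfrak{g}^*$ for $k=0,\dots,N-1$. Then the discrete forced Euler--Poincaré equations $$0=\mathcal{R}^*_{w_{k+1}}\, dl_d(w_{k+1})-Ad^*_{\varphi_d(w_k)}\,\mathcal{L}^*_{w_k}\, dl_d(w_k),\qquad k=0,\dots,N-2,$$ are equivalent to the forced discrete Lie--Poisson equations $$M_{k+1}=Ad^*_{w_k\varphi_d(w_k)}M_k,\qquad k=0,\dots,N-2.$$ Consequently the discrete flow $M_k\mapsto M_{k+1}$ preserves coadjoint orbits: if these equations hold, then $M_{k+1}\in\mathcal{O}_{M_k}$ for all $k=0,\dots,N-2$.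
   Context: $\mathcal{L}_w$ and $\mathcal{R}_w$ denote left and right multiplication by $w$ on $G$. The covectors $\mathcal{L}_w^*dl_d(w),\ \mathcal{R}_w^*dl_d(w)\in\mathfrak{g}^*$ are defined by $\langle\mathcal{L}_w^*dl_d(w),\eta\rangle=\langle dl_d(w),T_e\mathcal{L}_w\eta\rangle$ and $\langle\mathcal{R}_w^*dl_d(w),\eta\rangle=\langle dl_d(w),T_e\mathcal{R}_w\eta\rangle$ for all $\eta\in\mathfrak{g}=T_eG$. $Ad_g\colon\mathfrak{g}\to\mathfrak{g}$ is the adjoint action and $Ad_g^*\colon\mathfrak{g}^*\to\mathfrak{g}^*$ is its dual map, $\langle Ad_g^*\mu,\eta\rangle=\langle\mu,Ad_g\eta\rangle$. The coadjoint orbit through $\mu_0\in\mathfrak{g}^*$ is $\mathcal{O}_{\mu_0}=\{Ad^*_{g^{-1}}\mu_0\mid g\in G\}\subseteq\mathfrak{g}^*$. *)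

theory Defs
  imports "HOL-Analysis.Analysis" "HOL-Algebra.Group"
begin

section \<open>Smooth maps between finite-dimensional manifolds\<close>

text \<open>
  Model spaces are finite-dimensional real normed spaces rather than types of class
  \<open>euclidean_space\<close>: the latter have dimension at least 1, which would exclude manifolds of
  dimension 0 (such as countable discrete groups).
\<close>

definition finite_dimensional :: "'b::real_normed_vector itself \<Rightarrow> bool" where
  "finite_dimensional _ \<longleftrightarrow> (\<exists>B::'b set. finite B \<and> span B = UNIV)"

text \<open>
  \<open>f\<close> is \<open>n\<close> times continuously differentiable on the open set \<open>S\<close>.  Over a finite-dimensional
  domain it suffices to iterate the directional derivatives \<open>x \<mapsto> Df(x) v\<close>.
\<close>

fun Ck_on :: "nat \<Rightarrow> 'a::real_normed_vector set \<Rightarrow> ('a \<Rightarrow> 'b::real_normed_vector) \<Rightarrow> bool" where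
  "Ck_on 0 S f \<longleftrightarrow> continuous_on S f"
| "Ck_on (Suc n) S f \<longleftrightarrow>
     (\<forall>x\<in>S. f differentiable (at x)) \<and> (\<forall>v. Ck_on n S (\<lambda>x. frechet_derivative f (at x) v))"

definition smooth_on :: "'a::real_normed_vector set \<Rightarrow> ('a \<Rightarrow> 'b::real_normed_vector) \<Rightarrow> bool" where
  "smooth_on S f \<longleftrightarrow> (\<forall>n. Ck_on n S f)"

type_synonym ('a, 'b) chart = "'a set \<times> ('a \<Rightarrow> 'b)"

definition chart_on :: "'a topology \<Rightarrow> ('a, 'b::real_normed_vector) chart \<Rightarrow> bool" where
  "chart_on X = (\<lambda>(U, \<phi>). openin X U \<and> open (\<phi> ` U) \<and>
     homeomorphic_map (subtopology X U) (top_of_set (\<phi> ` U)) \<phi>)"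

text \<open>
  The atlas \<open>A\<close> need not be maximal: smoothness of maps depends only on the smooth structure
  that it generates.
\<close>

definition smooth_manifold :: "'a topology \<Rightarrow> ('a, 'b::real_normed_vector) chart set \<Rightarrow> bool" where
  "smooth_manifold X A \<longleftrightarrow>
     finite_dimensional TYPE('b) \<and> Hausdorff_space X \<and> second_countable X \<and>
     (\<forall>c\<in>A. chart_on X c) \<and> (\<Union>c\<in>A. fst c) = topspace X \<and>
     (\<forall>(U, \<phi>)\<in>A. \<forall>(V, \<psi>)\<in>A. smooth_on (\<phi> ` (U \<inter> V)) (\<psi> \<circ> inv_into U \<phi>))"

definition prod_atlas ::
    "('a, 'b) chart set \<Rightarrow> ('c, 'd) chart set \<Rightarrow> ('a \<times> 'c, 'b \<times> 'd) chart set" where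
  "prod_atlas A B = {(U \<times> V, map_prod \<phi> \<psi>) | U \<phi> V \<psi>. (U, \<phi>) \<in> A \<and> (V, \<psi>) \<in> B}"

definition smooth_map ::
    "'a topology \<Rightarrow> ('a, 'b::real_normed_vector) chart set \<Rightarrow>
     'c topology \<Rightarrow> ('c, 'd::real_normed_vector) chart set \<Rightarrow> ('a \<Rightarrow> 'c) \<Rightarrow> bool" where
  "smooth_map X A Y B F \<longleftrightarrow> continuous_map X Y F \<and>
     (\<forall>(U, \<phi>)\<in>A. \<forall>(V, \<psi>)\<in>B.
        smooth_on (\<phi> ` {x \<in> U. F x \<in> V}) (\<psi> \<circ> F \<circ> inv_into U \<phi>))"

abbreviation smooth_real ::
    "'a topology \<Rightarrow> ('a, 'b::real_normed_vector) chart set \<Rightarrow> ('a \<Rightarrow> real) \<Rightarrow> bool" where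
  "smooth_real X A \<equiv> smooth_map X A euclideanreal {(UNIV, id)}"


section \<open>Tangent vectors as derivations\<close>

text \<open>
  Functions, derivations and covectors have total HOL function types.  Each is normalised to be
  0 outside its proper domain, so that HOL equality is equality on that domain.
\<close>

definition zero_ext :: "'a set \<Rightarrow> ('a \<Rightarrow> real) \<Rightarrow> 'a \<Rightarrow> real" where
  "zero_ext S f = (\<lambda>x. if x \<in> S then f x else 0)"

definition C_inf :: "'a topology \<Rightarrow> ('a, 'b::real_normed_vector) chart set \<Rightarrow> ('a \<Rightarrow> real) set" where
  "C_inf X A = {f. smooth_real X A f \<and> (\<forall>x. x \<notin> topspace X \<longrightarrow> f x = 0)}"

definition tangent_space ::
    "'a topology \<Rightarrow> ('a, 'b::real_normed_vector) chart set \<Rightarrow> 'a \<Rightarrow> (('a \<Rightarrow> real) \<Rightarrow> real) set" where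
  "tangent_space X A p = {D.
     (\<forall>f\<in>C_inf X A. \<forall>g\<in>C_inf X A. D (\<lambda>x. f x + g x) = D f + D g) \<and>
     (\<forall>c. \<forall>f\<in>C_inf X A. D (\<lambda>x. c * f x) = c * D f) \<and>
     (\<forall>f\<in>C_inf X A. \<forall>g\<in>C_inf X A. D (\<lambda>x. f x * g x) = D f * g p + f p * D g) \<and>
     (\<forall>f. f \<notin> C_inf X A \<longrightarrow> D f = 0)}"

text \<open>
  The tangent map \<open>T\<^sub>p F\<close>, \<open>D \<mapsto> (f \<mapsto> D (f \<circ> F))\<close>.  The formula does not involve the
  base point \<open>p\<close>.
\<close>

definition tangent_map ::
    "'a topology \<Rightarrow> 'c topology \<Rightarrow> ('c, 'd::real_normed_vector) chart set \<Rightarrow> ('a \<Rightarrow> 'c) \<Rightarrow>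
     (('a \<Rightarrow> real) \<Rightarrow> real) \<Rightarrow> ('c \<Rightarrow> real) \<Rightarrow> real" where
  "tangent_map X Y B F D =
     (\<lambda>f. if f \<in> C_inf Y B then D (zero_ext (topspace X) (f \<circ> F)) else 0)"

definition differential ::
    "'a topology \<Rightarrow> ('a, 'b::real_normed_vector) chart set \<Rightarrow> ('a \<Rightarrow> real) \<Rightarrow> 'a \<Rightarrow>
     (('a \<Rightarrow> real) \<Rightarrow> real) \<Rightarrow> real" where
  "differential X A f p =
     (\<lambda>D. if D \<in> tangent_space X A p then D (zero_ext (topspace X) f) else 0)"


section \<open>Lie groups, the adjoint and the coadjoint action\<close>

record ('a, 'b) lie_structure = "'a monoid" +
  gtop :: "'a topology"
  atlas :: "('a, 'b) chart set"

locale lie_group = group G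
  for G :: "('a, 'b::real_normed_vector, 'm) lie_structure_scheme" (structure) +
  assumes topspace_gtop: "topspace (gtop G) = carrier G"
    and manifold: "smooth_manifold (gtop G) (atlas G)"
    and smooth_mult:
      "smooth_map (prod_topology (gtop G) (gtop G)) (prod_atlas (atlas G) (atlas G))
         (gtop G) (atlas G) (\<lambda>(x, y). x \<otimes> y)"
    and smooth_inv: "smooth_map (gtop G) (atlas G) (gtop G) (atlas G) (\<lambda>x. inv x)"

type_synonym 'a tvec = "('a \<Rightarrow> real) \<Rightarrow> real"
type_synonym 'a covec = "'a tvec \<Rightarrow> real"

definition lie_algebra ::
    "('a, 'b::real_normed_vector, 'm) lie_structure_scheme \<Rightarrow> 'a tvec set" where
  "lie_algebra G = tangent_space (gtop G) (atlas G) \<one>\<^bsub>G\<^esub>"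

definition lie_dual ::
    "('a, 'b::real_normed_vector, 'm) lie_structure_scheme \<Rightarrow> 'a covec set" where
  "lie_dual G = {\<mu>.
     (\<forall>\<eta>\<in>lie_algebra G. \<forall>\<xi>\<in>lie_algebra G. \<mu> (\<lambda>f. \<eta> f + \<xi> f) = \<mu> \<eta> + \<mu> \<xi>) \<and>
     (\<forall>c. \<forall>\<eta>\<in>lie_algebra G. \<mu> (\<lambda>f. c * \<eta> f) = c * \<mu> \<eta>) \<and>
     (\<forall>\<eta>. \<eta> \<notin> lie_algebra G \<longrightarrow> \<mu> \<eta> = 0)}"

definition lie_tangent ::
    "('a, 'b::real_normed_vector, 'm) lie_structure_scheme \<Rightarrow> ('a \<Rightarrow> 'a) \<Rightarrow> 'a tvec \<Rightarrow> 'a tvec" where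
  "lie_tangent G F = tangent_map (gtop G) (gtop G) (atlas G) F"

definition lie_d ::
    "('a, 'b::real_normed_vector, 'm) lie_structure_scheme \<Rightarrow> ('a \<Rightarrow> real) \<Rightarrow> 'a \<Rightarrow> 'a covec" where
  "lie_d G l w = differential (gtop G) (atlas G) l w"

definition left_mult :: "('a, 'm) monoid_scheme \<Rightarrow> 'a \<Rightarrow> 'a \<Rightarrow> 'a" where
  "left_mult G w = (\<lambda>x. w \<otimes>\<^bsub>G\<^esub> x)"

definition right_mult :: "('a, 'm) monoid_scheme \<Rightarrow> 'a \<Rightarrow> 'a \<Rightarrow> 'a" where
  "right_mult G w = (\<lambda>x. x \<otimes>\<^bsub>G\<^esub> w)"

text \<open>\<open>left_pull G w \<alpha>\<close> and \<open>right_pull G w \<alpha>\<close> pull \<open>\<alpha> \<in> T\<^sub>w\<^sup>* G\<close> back to the unit.\<close>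

definition left_pull ::
    "('a, 'b::real_normed_vector, 'm) lie_structure_scheme \<Rightarrow> 'a \<Rightarrow> 'a covec \<Rightarrow> 'a covec" where
  "left_pull G w \<alpha> =
     (\<lambda>\<eta>. if \<eta> \<in> lie_algebra G then \<alpha> (lie_tangent G (left_mult G w) \<eta>) else 0)"

definition right_pull ::
    "('a, 'b::real_normed_vector, 'm) lie_structure_scheme \<Rightarrow> 'a \<Rightarrow> 'a covec \<Rightarrow> 'a covec" where
  "right_pull G w \<alpha> =
     (\<lambda>\<eta>. if \<eta> \<in> lie_algebra G then \<alpha> (lie_tangent G (right_mult G w) \<eta>) else 0)"

definition Ad ::
    "('a, 'b::real_normed_vector, 'm) lie_structure_scheme \<Rightarrow> 'a \<Rightarrow> 'a tvec \<Rightarrow> 'a tvec" where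
  "Ad G g = lie_tangent G (\<lambda>x. g \<otimes>\<^bsub>G\<^esub> x \<otimes>\<^bsub>G\<^esub> inv\<^bsub>G\<^esub> g)"

text \<open>The plain dual map of \<open>Ad G g\<close>, hence contravariant in \<open>g\<close>.\<close>

definition Ad_dual ::
    "('a, 'b::real_normed_vector, 'm) lie_structure_scheme \<Rightarrow> 'a \<Rightarrow> 'a covec \<Rightarrow> 'a covec" where
  "Ad_dual G g \<mu> = (\<lambda>\<eta>. if \<eta> \<in> lie_algebra G then \<mu> (Ad G g \<eta>) else 0)"

definition coadjoint_orbit ::
    "('a, 'b::real_normed_vector, 'm) lie_structure_scheme \<Rightarrow> 'a covec \<Rightarrow> 'a covec set" where
  "coadjoint_orbit G \<mu> = {Ad_dual G (inv\<^bsub>G\<^esub> g) \<mu> | g. g \<in> carrier G}"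

end

theory Submission
  imports Defs
begin

text \<open>
  The equivalence is the identity \<open>Ad\<^sub>w\<^sup>* \<R>\<^sub>w\<^sup>* = \<L>\<^sub>w\<^sup>*\<close> (lemma \<open>Ad_dual_right_pull\<close>): conjugating
  by \<open>w\<close> and then multiplying by \<open>w\<close> on the right is multiplying by \<open>w\<close> on the left.  Since
  \<open>g \<mapsto> Ad\<^sub>g\<^sup>*\<close> reverses products (\<open>Ad_dual_mult\<close>), the momentum \<open>M = \<R>\<^sub>w\<^sup>* dl(w)\<close> satisfies
  \<open>Ad\<^sup>*\<close> of \<open>w \<phi>\<close> applied to \<open>M\<close> \<open>=\<close> \<open>Ad\<^sub>\<phi>\<^sup>* \<L>\<^sub>w\<^sup>* dl(w)\<close>, so the two systems of equations agree
  one index at a time.  Orbits are preserved because \<open>Ad\<^sub>g\<^sup>*\<close> is the coadjoint action of \<open>g\<^sup>-\<^sup>1\<close>.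

  These identities express the chain rule for tangent maps.  For tangent vectors as derivations
  the chain rule is formal once composition with translations is known to preserve smooth real
  functions, and proving that from the smoothness of multiplication and inversion in charts
  takes most of the work (\<open>smooth_map_pulls_back\<close>, \<open>smooth_map_slice\<close>).  It rests on the chain
  rule for \<open>C\<^sup>k\<close> functions (\<open>Ck_on_compose\<close>).  As \<open>C\<^sup>k\<close> is defined by directional derivatives
  one direction at a time, that rule needs bounded coordinate functionals on the model space,
  which come from the closedness of finite-dimensional subspaces.
\<close>

section \<open>Coordinates in a finite-dimensional normed space\<close>

text \<open>
  The component of a vector along \<open>b\<close> modulo \<open>V\<close> is a bounded functional, with bound the inverse of
  the distance \<open>d\<close> from \<open>b\<close> to \<open>V\<close>: rescale \<open>s + k b\<close> to \<open>b + s/k\<close>.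
\<close>

lemma closed_subspace_separation:
  fixes V :: "'a::real_normed_vector set"
  assumes "subspace V" "closed V" "b \<notin> V"
  obtains d where "d > 0" "\<And>s k. s \<in> V \<Longrightarrow> d * \<bar>k\<bar> \<le> norm (s + k *\<^sub>R b)"
proof
  have ne: "V \<noteq> {}" using subspace_0[OF assms(1)] by auto
  show "infdist b V > 0"
    using in_closed_iff_infdist_zero[OF assms(2) ne] assms(3) infdist_nonneg[of b V]
    by (simp add: less_le)
  fix s k assume s: "s \<in> V"
  show "infdist b V * \<bar>k\<bar> \<le> norm (s + k *\<^sub>R b)"
  proof (cases "k = 0")
    case False
    have "(- (1 / k)) *\<^sub>R s \<in> V" using subspace_scale[OF assms(1) s] .
    then have "infdist b V \<le> dist b ((- (1 / k)) *\<^sub>R s)" by (rule infdist_le)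
    also have "\<dots> = norm ((1 / k) *\<^sub>R (s + k *\<^sub>R b))"
      using False by (simp add: dist_norm scaleR_add_right add.commute)
    also have "\<dots> = norm (s + k *\<^sub>R b) / \<bar>k\<bar>" by simp
    finally show ?thesis
      using False by (simp add: pos_le_divide_eq)
  qed simp
qed

text \<open>
  Induction on the spanning set.  Along a convergent sequence the \<open>b\<close>-components are Cauchy by
  the preceding bound, and what remains after removing them converges in the smaller span.
\<close>

lemma closed_span_finite:
  fixes B :: "'a::real_normed_vector set"
  assumes "finite B"
  shows "closed (span B)"
  using assms
proof (induction B)
  case empty
  then show ?case by simp
next
  case (insert b B)
  show ?case
  proof (cases "b \<in> span B")
    case True
    then show ?thesis using insert.IH by (simp add: span_redundant)
  next
    case False
    obtain d where d: "d > 0" "\<And>s k. s \<in> span B \<Longrightarrow> d * \<bar>k\<bar> \<le> norm (s + k *\<^sub>R b)"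
      using closed_subspace_separation[OF subspace_span insert.IH False] by blast
    show ?thesis
      unfolding closed_sequential_limits
    proof (intro allI impI, elim conjE)
      fix x l assume x: "\<forall>n. x n \<in> span (insert b B)" and lim: "x \<longlonglongrightarrow> l"
      have "\<forall>n. \<exists>k. x n - k *\<^sub>R b \<in> span B" using x by (simp add: span_breakdown_eq)
      then obtain k where k: "\<And>n. x n - k n *\<^sub>R b \<in> span B" by metis
      have kx: "d * \<bar>k m - k n\<bar> \<le> norm (x m - x n)" for m n
        using d(2)[OF span_diff[OF k[of m] k[of n]], of "k m - k n"]
        by (simp add: algebra_simps)
      have "Cauchy k"
      proof (rule metric_CauchyI)
        fix e :: real assume "e > 0"
        then have "d * e > 0" using d by simp
        with LIMSEQ_imp_Cauchy[OF lim] obtain M where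
          M: "\<And>m n. m \<ge> M \<Longrightarrow> n \<ge> M \<Longrightarrow> dist (x m) (x n) < d * e"
          by (meson metric_CauchyD)
        show "\<exists>M. \<forall>m\<ge>M. \<forall>n\<ge>M. dist (k m) (k n) < e"
        proof (intro exI allI impI)
          fix m n assume "m \<ge> M" "n \<ge> M"
          then have "d * \<bar>k m - k n\<bar> < d * e"
            using M[of m n] kx[of m n] by (simp add: dist_norm)
          then show "dist (k m) (k n) < e" using d by (simp add: dist_real_def)
        qed
      qed
      then obtain c where c: "k \<longlonglongrightarrow> c" using Cauchy_convergent convergent_def by blast
      have "(\<lambda>n. x n - k n *\<^sub>R b) \<longlonglongrightarrow> l - c *\<^sub>R b" by (intro tendsto_intros lim c)
      then have "l - c *\<^sub>R b \<in> span B"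
        by (rule closed_sequentially[OF insert.IH k])
      then show "l \<in> span (insert b B)" using span_breakdown_eq by blast
    qed
  qed
qed

text \<open>
  The coordinate of \<open>x\<close> along a basis vector \<open>b\<close> is bounded because \<open>b\<close> has positive distance to
  the span of the other basis vectors, which is closed.
\<close>

lemma finite_dimensional_coordinates:
  assumes "finite_dimensional TYPE('v::real_normed_vector)"
  obtains B :: "'v::real_normed_vector set" and c :: "'v \<Rightarrow> 'v \<Rightarrow> real" where
    "finite B" "\<And>b. b \<in> B \<Longrightarrow> bounded_linear (c b)" "\<And>x. x = (\<Sum>b\<in>B. c b x *\<^sub>R b)"
proof -
  obtain B0 :: "'v set" where B0: "finite B0" "span B0 = UNIV"
    using assms unfolding finite_dimensional_def by blast
  obtain B where B: "B \<subseteq> B0" "independent B" "B0 \<subseteq> span B"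
    using maximal_independent_subset by blast
  have fin: "finite B" using B B0 finite_subset by blast
  have "span B0 \<subseteq> span B" using span_mono[OF B(3)] by (simp add: span_span)
  then have sp: "span B = UNIV" using B0 by auto
  have ex: "x = (\<Sum>b\<in>B. representation B x b *\<^sub>R b)" for x
    using sum_representation_eq[OF B(2) _ fin, of x] sp by auto
  have "bounded_linear (\<lambda>x. representation B x b)" if b: "b \<in> B" for b
  proof -
    have "b \<notin> span (B - {b})" using B(2) b unfolding dependent_def by auto
    from closed_subspace_separation[OF subspace_span closed_span_finite this] fin
    obtain d where d: "d > 0" "\<And>s k. s \<in> span (B - {b}) \<Longrightarrow> d * \<bar>k\<bar> \<le> norm (s + k *\<^sub>R b)"
      by auto
    show ?thesis
    proof (rule bounded_linear_intro)
      fix x y r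
      show "representation B (x + y) b = representation B x b + representation B y b"
        using representation_add[OF B(2), of y x] sp by auto
      show "representation B (r *\<^sub>R x) b = r *\<^sub>R representation B x b"
        using representation_scale[OF B(2), of x r] sp by auto
      have "(\<Sum>a\<in>B - {b}. representation B x a *\<^sub>R a) \<in> span (B - {b})"
        by (intro span_sum span_scale span_base)
      from d(2)[OF this, of "representation B x b"]
      have "d * \<bar>representation B x b\<bar> \<le> norm x"
        using ex[of x] sum.remove[OF fin b, of "\<lambda>a. representation B x a *\<^sub>R a"]
        by (simp add: add.commute)
      then show "norm (representation B x b) \<le> norm x * (1 / d)"
        using d(1) by (simp add: field_simps)
    qed
  qed
  with that[of B "\<lambda>b x. representation B x b"] fin ex show thesis by blast
qed


section \<open>Calculus of iterated directional derivatives\<close>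

lemma Ck_on_cong:
  assumes "open S" "\<And>x. x \<in> S \<Longrightarrow> f x = g x" "Ck_on n S f"
  shows "Ck_on n S g"
  using assms(2,3)
proof (induction n arbitrary: f g)
  case 0
  then show ?case using continuous_on_cong[of S S f g] by simp
next
  case (Suc n)
  have D: "(g has_derivative frechet_derivative f (at x)) (at x)" if "x \<in> S" for x
    using Suc.prems(2) that
    by (intro has_derivative_transform_within_open[OF _ assms(1) that Suc.prems(1)])
      (simp_all add: frechet_derivative_works)
  then have "frechet_derivative f (at x) = frechet_derivative g (at x)" if "x \<in> S" for x
    using frechet_derivative_at that by metis
  then have "Ck_on n S (\<lambda>x. frechet_derivative g (at x) v)" for v
    using Suc.IH[of "\<lambda>x. frechet_derivative f (at x) v"] Suc.prems(2) by simp
  then show ?case using D by (auto simp: differentiable_def)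
qed

text \<open>
  \<open>Ck_on\<close> is phrased by \<open>frechet_derivative\<close>, a choice operator; this rule allows any explicit
  formula for the derivative instead, as the calculus rules provide it.
\<close>

lemma Ck_on_SucI:
  assumes "open S" "\<And>x. x \<in> S \<Longrightarrow> (f has_derivative f' x) (at x)"
    "\<And>v. Ck_on n S (\<lambda>x. f' x v)"
  shows "Ck_on (Suc n) S f"
proof -
  have "f' x = frechet_derivative f (at x)" if "x \<in> S" for x
    using frechet_derivative_at[OF assms(2)[OF that]] .
  then have "Ck_on n S (\<lambda>x. frechet_derivative f (at x) v)" for v
    using Ck_on_cong[OF assms(1) _ assms(3)] by simp
  then show ?thesis using assms(2) by (auto simp: differentiable_def)
qed

lemma Ck_on_Suc_derivative:
  "Ck_on (Suc n) S f \<Longrightarrow> x \<in> S \<Longrightarrow> (f has_derivative frechet_derivative f (at x)) (at x)"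
  by (simp add: frechet_derivative_works)

lemma Ck_on_SucD: "Ck_on (Suc n) S f \<Longrightarrow> Ck_on n S f"
proof (induction n arbitrary: f)
  case 0
  then show ?case
    by (auto intro!: continuous_at_imp_continuous_on differentiable_imp_continuous_within)
next
  case (Suc n)
  then show ?case by (metis Ck_on.simps(2))
qed

lemma Ck_on_local:
  assumes "\<And>x. x \<in> S \<Longrightarrow> \<exists>T. open T \<and> x \<in> T \<and> Ck_on n T f"
  shows "Ck_on n S f"
  using assms
proof (induction n arbitrary: f)
  case 0
  have "isCont f x" if "x \<in> S" for x
    using 0[OF that] by (auto simp: continuous_on_eq_continuous_at)
  then show ?case by (auto intro: continuous_at_imp_continuous_on)
next
  case (Suc n)
  have "f differentiable (at x)" if "x \<in> S" for x
    using Suc.prems[OF that] by auto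
  moreover have "Ck_on n S (\<lambda>x. frechet_derivative f (at x) v)" for v
    by (rule Suc.IH) (use Suc.prems in fastforce)
  ultimately show ?case by simp
qed

lemma Ck_on_const: "Ck_on n S (\<lambda>x. c)"
  by (induction n arbitrary: c) (simp_all add: frechet_derivative_const)

text \<open>
  An affine inner map has constant derivative, so every directional derivative of the composite is
  again a composite of the same shape.  Restricting a function to a slice of a product is the
  intended case.
\<close>

lemma Ck_on_affine:
  assumes "open T" "bounded_linear A" "\<And>x. x \<in> T \<Longrightarrow> c + A x \<in> S" "Ck_on n S f"
  shows "Ck_on n T (\<lambda>x. f (c + A x))"
  using assms(4)
proof (induction n arbitrary: f)
  case 0
  have "continuous_on T (\<lambda>x. c + A x)"
    by (intro continuous_intros linear_continuous_on assms(2))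
  then show ?case
    using 0 assms(3) continuous_on_compose2[of S f T "\<lambda>x. c + A x"] by auto
next
  case (Suc n)
  show ?case
  proof (rule Ck_on_SucI[OF assms(1)])
    fix x assume "x \<in> T"
    have "((\<lambda>x. c + A x) has_derivative A) (at x)"
      using has_derivative_add[OF has_derivative_const
          bounded_linear_imp_has_derivative[OF assms(2)]] by simp
    then show "((\<lambda>x. f (c + A x)) has_derivative
        (\<lambda>v. frechet_derivative f (at (c + A x)) (A v))) (at x)"
      using has_derivative_compose Ck_on_Suc_derivative[OF Suc.prems assms(3)[OF \<open>x \<in> T\<close>]]
      by blast
  next
    fix v
    show "Ck_on n T (\<lambda>x. frechet_derivative f (at (c + A x)) (A v))"
      using Suc.prems by (intro Suc.IH) simp
  qed
qed

lemma Ck_on_linear: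
  assumes "open S" "bounded_linear h" "Ck_on n S f"
  shows "Ck_on n S (\<lambda>x. h (f x))"
  using assms(3)
proof (induction n arbitrary: f)
  case 0
  then show ?case using bounded_linear.continuous_on[OF assms(2)] by simp
next
  case (Suc n)
  show ?case
  proof (rule Ck_on_SucI[OF assms(1)])
    show "((\<lambda>x. h (f x)) has_derivative (\<lambda>v. h (frechet_derivative f (at x) v))) (at x)"
      if "x \<in> S" for x
      using bounded_linear.has_derivative[OF assms(2) Ck_on_Suc_derivative[OF Suc.prems that]] .
  qed (use Suc in simp)
qed

lemma Ck_on_add:
  assumes "open S" "Ck_on n S f" "Ck_on n S g"
  shows "Ck_on n S (\<lambda>x. f x + g x)"
  using assms(2,3)
proof (induction n arbitrary: f g)
  case 0
  then show ?case by (simp add: continuous_on_add)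
next
  case (Suc n)
  show ?case
  proof (rule Ck_on_SucI[OF assms(1)])
    show "((\<lambda>x. f x + g x) has_derivative
        (\<lambda>v. frechet_derivative f (at x) v + frechet_derivative g (at x) v)) (at x)"
      if "x \<in> S" for x
      using Ck_on_Suc_derivative[OF Suc.prems(1) that] Ck_on_Suc_derivative[OF Suc.prems(2) that]
      by (rule has_derivative_add)
  qed (use Suc in simp)
qed

lemma Ck_on_sum:
  assumes "open S" "finite I" "\<And>i. i \<in> I \<Longrightarrow> Ck_on n S (f i)"
  shows "Ck_on n S (\<lambda>x. \<Sum>i\<in>I. f i x)"
  using assms(2,3)
  by (induction I) (simp_all add: Ck_on_const Ck_on_add[OF assms(1)])

lemma Ck_on_bilinear:
  assumes "open S" "bounded_bilinear h" "Ck_on n S f" "Ck_on n S g"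
  shows "Ck_on n S (\<lambda>x. h (f x) (g x))"
  using assms(3,4)
proof (induction n arbitrary: f g)
  case 0
  then show ?case using bounded_bilinear.continuous_on[OF assms(2)] by simp
next
  case (Suc n)
  show ?case
  proof (rule Ck_on_SucI[OF assms(1)])
    show "((\<lambda>x. h (f x) (g x)) has_derivative
        (\<lambda>v. h (f x) (frechet_derivative g (at x) v) + h (frechet_derivative f (at x) v) (g x)))
        (at x)" if "x \<in> S" for x
      using bounded_bilinear.FDERIV[OF assms(2) Ck_on_Suc_derivative[OF Suc.prems(1) that]
          Ck_on_Suc_derivative[OF Suc.prems(2) that]] .
  next
    fix v
    show "Ck_on n S (\<lambda>x. h (f x) (frechet_derivative g (at x) v)
        + h (frechet_derivative f (at x) v) (g x))"
      using Suc.prems Ck_on_SucD[OF Suc.prems(1)] Ck_on_SucD[OF Suc.prems(2)]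
      by (intro Ck_on_add[OF assms(1)] Suc.IH) simp_all
  qed
qed

text \<open>
  The derivative of \<open>g \<circ> f\<close> in direction \<open>v\<close> is \<open>Dg(f x)(Df(x) v)\<close>, where the direction fed to \<open>Dg\<close>
  varies with \<open>x\<close>, whereas the hypothesis on \<open>g\<close> is about fixed directions.  Expanding
  \<open>Df(x) v\<close> in a basis gives a finite sum of products \<open>c\<^sub>b(Df(x) v) Dg(f x) b\<close>, and the induction
  hypothesis applies to each second factor.
\<close>

lemma Ck_on_compose:
  fixes f :: "'a::real_normed_vector \<Rightarrow> 'b::real_normed_vector"
  assumes "finite_dimensional TYPE('b)" "open S" "f ` S \<subseteq> T" "Ck_on n S f" "Ck_on n T g"
  shows "Ck_on n S (\<lambda>x. g (f x))"
  using assms(4,5)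
proof (induction n arbitrary: g)
  case 0
  then show ?case using assms(3) continuous_on_compose2 by auto
next
  case (Suc n)
  obtain B and c :: "'b \<Rightarrow> 'b \<Rightarrow> real" where B: "finite B"
    "\<And>b. b \<in> B \<Longrightarrow> bounded_linear (c b)" "\<And>x. x = (\<Sum>b\<in>B. c b x *\<^sub>R b)"
    using finite_dimensional_coordinates[OF assms(1)] by blast
  show ?case
  proof (rule Ck_on_SucI[OF assms(2)])
    fix x assume x: "x \<in> S"
    then have fx: "f x \<in> T" using assms(3) by auto
    note Dg = Ck_on_Suc_derivative[OF Suc.prems(2) fx]
    let ?g' = "frechet_derivative g (at (f x))" and ?f' = "frechet_derivative f (at x)"
    have lin: "linear ?g'" using has_derivative_linear[OF Dg] .
    have "?g' u = (\<Sum>b\<in>B. c b u *\<^sub>R ?g' b)" for u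
    proof -
      have "?g' u = ?g' (\<Sum>b\<in>B. c b u *\<^sub>R b)" using B(3)[of u] by simp
      also have "\<dots> = (\<Sum>b\<in>B. c b u *\<^sub>R ?g' b)"
        by (simp add: linear_sum[OF lin] linear_scale[OF lin])
      finally show ?thesis .
    qed
    then have "(\<lambda>v. \<Sum>b\<in>B. c b (?f' v) *\<^sub>R ?g' b) = (\<lambda>v. ?g' (?f' v))" by metis
    then show "((\<lambda>x. g (f x)) has_derivative (\<lambda>v. \<Sum>b\<in>B. c b (?f' v) *\<^sub>R ?g' b)) (at x)"
      using has_derivative_compose[OF Ck_on_Suc_derivative[OF Suc.prems(1) x] Dg] by simp
  next
    fix v
    show "Ck_on n S (\<lambda>x. \<Sum>b\<in>B. c b (frechet_derivative f (at x) v)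
        *\<^sub>R frechet_derivative g (at (f x)) b)"
    proof (rule Ck_on_sum[OF assms(2) B(1)])
      fix b assume b: "b \<in> B"
      have "Ck_on n S (\<lambda>x. c b (frechet_derivative f (at x) v))"
        using Suc.prems(1) by (intro Ck_on_linear[OF assms(2) B(2)[OF b]]) simp
      moreover have "Ck_on n S (\<lambda>x. frechet_derivative g (at (f x)) b)"
        using Suc.prems(2) by (intro Suc.IH[OF Ck_on_SucD[OF Suc.prems(1)]]) simp
      ultimately show "Ck_on n S (\<lambda>x. c b (frechet_derivative f (at x) v)
          *\<^sub>R frechet_derivative g (at (f x)) b)"
        by (rule Ck_on_bilinear[OF assms(2) bounded_bilinear_scaleR])
    qed
  qed
qed


section \<open>Smooth functions on manifolds\<close>

lemma smooth_realD:
  assumes "smooth_real X A f" "(U, \<phi>) \<in> A"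
  shows "smooth_on (\<phi> ` U) (\<lambda>z. f (inv_into U \<phi> z))"
  using assms unfolding smooth_map_def by (auto simp: o_def)

lemma smooth_realI:
  assumes "continuous_map X euclideanreal f"
    "\<And>U \<phi>. (U, \<phi>) \<in> A \<Longrightarrow> smooth_on (\<phi> ` U) (\<lambda>z. f (inv_into U \<phi> z))"
  shows "smooth_real X A f"
  using assms unfolding smooth_map_def by (auto simp: o_def)

lemma chart_facts:
  assumes "smooth_manifold X A" "(U, \<phi>) \<in> A"
  shows chart_subset: "U \<subseteq> topspace X"
    and chart_inj: "inj_on \<phi> U"
    and open_chart_image: "\<And>W. openin X W \<Longrightarrow> open (\<phi> ` (U \<inter> W))"
proof -
  have c: "openin X U" "open (\<phi> ` U)"
    "homeomorphic_map (subtopology X U) (top_of_set (\<phi> ` U)) \<phi>"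
    using assms unfolding smooth_manifold_def chart_on_def by auto
  show U: "U \<subseteq> topspace X" using c(1) openin_subset by blast
  then have "topspace (subtopology X U) = U" by auto
  then show "inj_on \<phi> U"
    using homeomorphic_imp_injective_map[OF c(3)] by simp
  show "open (\<phi> ` (U \<inter> W))" if "openin X W" for W
  proof -
    have "openin (subtopology X U) (U \<inter> W)" using that by (metis Int_commute openin_subtopology)
    then have "openin (top_of_set (\<phi> ` U)) (\<phi> ` (U \<inter> W))"
      using homeomorphic_imp_open_map[OF c(3)] unfolding open_map_def by blast
    then show ?thesis using c(2) openin_open_eq by blast
  qed
qed

lemma open_chart_domain:
  assumes "smooth_manifold X A" "(U, \<phi>) \<in> A"
  shows "open (\<phi> ` U)"
  using open_chart_image[OF assms openin_topspace] chart_subset[OF assms] by (simp add: Int_absorb2)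

lemma open_chart_preimage:
  assumes "smooth_manifold X A" "(U, \<phi>) \<in> A" "smooth_manifold Y B" "(V, \<psi>) \<in> B"
    "continuous_map X Y F"
  shows "open (\<phi> ` {x \<in> U. F x \<in> V})"
proof -
  have "openin Y V" using assms(3,4) unfolding smooth_manifold_def chart_on_def by auto
  then have "openin X {x \<in> topspace X. F x \<in> V}"
    using assms(5) by (simp add: openin_continuous_map_preimage)
  then have "open (\<phi> ` (U \<inter> {x \<in> topspace X. F x \<in> V}))"
    by (rule open_chart_image[OF assms(1,2)])
  moreover have "U \<inter> {x \<in> topspace X. F x \<in> V} = {x \<in> U. F x \<in> V}"
    using chart_subset[OF assms(1,2)] by auto
  ultimately show ?thesis by simp
qed

lemma chart_cover:
  assumes "smooth_manifold X A" "x \<in> topspace X"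
  obtains U \<phi> where "(U, \<phi>) \<in> A" "x \<in> U"
proof -
  have "x \<in> (\<Union>c\<in>A. fst c)" using assms unfolding smooth_manifold_def by simp
  then show thesis using that by auto
qed

lemma C_inf_add:
  assumes "smooth_manifold X A" "f \<in> C_inf X A" "g \<in> C_inf X A"
  shows "(\<lambda>x. f x + g x) \<in> C_inf X A"
proof -
  have sm: "smooth_real X A f" "smooth_real X A g" using assms unfolding C_inf_def by auto
  have "smooth_real X A (\<lambda>x. f x + g x)"
  proof (rule smooth_realI)
    show "continuous_map X euclideanreal (\<lambda>x. f x + g x)"
      using sm by (intro continuous_map_add) (auto simp: smooth_map_def)
    show "smooth_on (\<phi> ` U) (\<lambda>z. f (inv_into U \<phi> z) + g (inv_into U \<phi> z))"
      if "(U, \<phi>) \<in> A" for U \<phi>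
      using Ck_on_add[OF open_chart_domain[OF assms(1) that]] smooth_realD[OF _ that] sm
      unfolding smooth_on_def by blast
  qed
  then show ?thesis using assms unfolding C_inf_def by auto
qed

lemma C_inf_mult:
  assumes "smooth_manifold X A" "f \<in> C_inf X A" "g \<in> C_inf X A"
  shows "(\<lambda>x. f x * g x) \<in> C_inf X A"
proof -
  have sm: "smooth_real X A f" "smooth_real X A g" using assms unfolding C_inf_def by auto
  have "smooth_real X A (\<lambda>x. f x * g x)"
  proof (rule smooth_realI)
    show "continuous_map X euclideanreal (\<lambda>x. f x * g x)"
      using sm by (intro continuous_map_real_mult) (auto simp: smooth_map_def)
    show "smooth_on (\<phi> ` U) (\<lambda>z. f (inv_into U \<phi> z) * g (inv_into U \<phi> z))"
      if "(U, \<phi>) \<in> A" for U \<phi>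
      using Ck_on_bilinear[OF open_chart_domain[OF assms(1) that] bounded_bilinear_mult]
        smooth_realD[OF _ that] sm
      unfolding smooth_on_def by blast
  qed
  then show ?thesis using assms unfolding C_inf_def by auto
qed

lemma C_inf_scale:
  assumes "smooth_manifold X A" "f \<in> C_inf X A"
  shows "(\<lambda>x. c * f x) \<in> C_inf X A"
proof -
  have sm: "smooth_real X A f" using assms unfolding C_inf_def by auto
  have "smooth_real X A (\<lambda>x. c * f x)"
  proof (rule smooth_realI)
    show "continuous_map X euclideanreal (\<lambda>x. c * f x)"
      using sm by (intro continuous_map_real_mult_left) (auto simp: smooth_map_def)
    show "smooth_on (\<phi> ` U) (\<lambda>z. c * f (inv_into U \<phi> z))"
      if "(U, \<phi>) \<in> A" for U \<phi>
      using Ck_on_linear[OF open_chart_domain[OF assms(1) that] bounded_linear_mult_right]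
        smooth_realD[OF _ that] sm
      unfolding smooth_on_def by blast
  qed
  then show ?thesis using assms unfolding C_inf_def by auto
qed

text \<open>
  Smoothness of a map expressed on function algebras: composition with it carries smooth functions
  to smooth functions.  Tangent maps see a map only through these compositions, so this is the
  form in which smoothness enters everything below, and unlike the formulation by charts it is
  visibly stable under composition of maps.
\<close>

definition pulls_back ::
    "'a topology \<Rightarrow> ('a, 'b::real_normed_vector) chart set \<Rightarrow>
     'c topology \<Rightarrow> ('c, 'd::real_normed_vector) chart set \<Rightarrow> ('a \<Rightarrow> 'c) \<Rightarrow> bool" where
  "pulls_back X A Y B F \<longleftrightarrow> F \<in> topspace X \<rightarrow> topspace Y \<and>
     (\<forall>f\<in>C_inf Y B. zero_ext (topspace X) (f \<circ> F) \<in> C_inf X A)"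

text \<open>
  Near a point \<open>x\<close>, for a chart \<open>\<psi>\<close> around \<open>F x\<close>, the local representative of \<open>f \<circ> F\<close> factors as
  \<open>f \<circ> \<psi>\<^sup>-\<^sup>1\<close> after the representative \<open>\<psi> \<circ> F \<circ> \<phi>\<^sup>-\<^sup>1\<close> of \<open>F\<close>.
\<close>

lemma smooth_map_pulls_back_smooth_real:
  fixes A :: "('a, 'b::real_normed_vector) chart set"
    and B :: "('c, 'd::real_normed_vector) chart set"
  assumes "smooth_manifold X A" "smooth_manifold Y B" "smooth_map X A Y B F" "smooth_real Y B f"
  shows "zero_ext (topspace X) (f \<circ> F) \<in> C_inf X A"
proof -
  have F: "continuous_map X Y F" using assms(3) by (simp add: smooth_map_def)
  have f: "continuous_map Y euclideanreal f" using assms(4) by (simp add: smooth_map_def)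
  have fd: "finite_dimensional TYPE('d)" using assms(2) by (simp add: smooth_manifold_def)
  let ?h = "zero_ext (topspace X) (f \<circ> F)"
  have "smooth_real X A ?h"
  proof (rule smooth_realI)
    show "continuous_map X euclideanreal ?h"
      by (rule continuous_map_eq[OF continuous_map_compose[OF F f]]) (simp add: zero_ext_def)
    fix U \<phi> assume U: "(U, \<phi>) \<in> A"
    have "Ck_on n (\<phi> ` U) (\<lambda>z. ?h (inv_into U \<phi> z))" for n
    proof (rule Ck_on_local)
      fix z assume "z \<in> \<phi> ` U"
      then obtain x where x: "x \<in> U" "z = \<phi> x" by blast
      then have "F x \<in> topspace Y"
        using continuous_map_funspace[OF F] chart_subset[OF assms(1) U] by blast
      then obtain V \<psi> where V: "(V, \<psi>) \<in> B" "F x \<in> V" using chart_cover[OF assms(2)] by blast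
      let ?S = "\<phi> ` {x \<in> U. F x \<in> V}"
      have S: "open ?S" using open_chart_preimage[OF assms(1) U assms(2) V(1) F] .
      have inv: "inv_into U \<phi> (\<phi> y) = y" if "y \<in> U" for y
        using chart_inj[OF assms(1) U] that by simp
      have "Ck_on n ?S (\<lambda>z. f (inv_into V \<psi> (\<psi> (F (inv_into U \<phi> z)))))"
      proof (rule Ck_on_compose[OF fd S, where f = "\<lambda>z. \<psi> (F (inv_into U \<phi> z))"
            and g = "\<lambda>u. f (inv_into V \<psi> u)" and T = "\<psi> ` V"])
        show "(\<lambda>z. \<psi> (F (inv_into U \<phi> z))) ` ?S \<subseteq> \<psi> ` V" using inv by auto
        show "Ck_on n ?S (\<lambda>z. \<psi> (F (inv_into U \<phi> z)))"
          using assms(3) U V(1) unfolding smooth_map_def smooth_on_def by (fastforce simp: o_def)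
        show "Ck_on n (\<psi> ` V) (\<lambda>u. f (inv_into V \<psi> u))"
          using smooth_realD[OF assms(4) V(1)] unfolding smooth_on_def by blast
      qed
      then have "Ck_on n ?S (\<lambda>z. ?h (inv_into U \<phi> z))"
        by (rule Ck_on_cong[OF S, rotated])
          (use inv chart_inj[OF assms(2) V(1)] chart_subset[OF assms(1) U] in
            \<open>auto simp: zero_ext_def\<close>)
      moreover have "z \<in> ?S" using x V by blast
      ultimately show "\<exists>T. open T \<and> z \<in> T \<and> Ck_on n T (\<lambda>z. ?h (inv_into U \<phi> z))"
        using S by blast
    qed
    then show "smooth_on (\<phi> ` U) (\<lambda>z. ?h (inv_into U \<phi> z))" by (simp add: smooth_on_def)
  qed
  then show ?thesis by (simp add: C_inf_def zero_ext_def)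
qed

lemma smooth_map_pulls_back:
  assumes "smooth_manifold X A" "smooth_manifold Y B" "smooth_map X A Y B F"
  shows "pulls_back X A Y B F"
  unfolding pulls_back_def
proof
  show "F \<in> topspace X \<rightarrow> topspace Y"
    using assms(3) continuous_map_funspace unfolding smooth_map_def by blast
  show "\<forall>f\<in>C_inf Y B. zero_ext (topspace X) (f \<circ> F) \<in> C_inf X A"
  proof
    fix f assume "f \<in> C_inf Y B"
    then have "smooth_real Y B f" by (simp add: C_inf_def)
    then show "zero_ext (topspace X) (f \<circ> F) \<in> C_inf X A"
      by (rule smooth_map_pulls_back_smooth_real[OF assms])
  qed
qed

lemma zero_ext_compose:
  assumes "F \<in> S \<rightarrow> T" "\<And>x. x \<in> S \<Longrightarrow> K x = H (F x)"
  shows "zero_ext S (f \<circ> K) = zero_ext S (zero_ext T (f \<circ> H) \<circ> F)"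
  using assms by (auto simp: zero_ext_def fun_eq_iff Pi_iff)

lemma pulls_back_compose:
  assumes "pulls_back X A Y B F" "pulls_back Y B Z C H" "\<And>x. x \<in> topspace X \<Longrightarrow> K x = H (F x)"
  shows "pulls_back X A Z C K"
  unfolding pulls_back_def
proof (intro conjI ballI)
  have F: "F \<in> topspace X \<rightarrow> topspace Y" using assms(1) by (simp add: pulls_back_def)
  show "K \<in> topspace X \<rightarrow> topspace Z"
    using assms(2,3) F by (auto simp: pulls_back_def Pi_iff)
  fix f assume "f \<in> C_inf Z C"
  then have "zero_ext (topspace Y) (f \<circ> H) \<in> C_inf Y B"
    using assms(2) by (simp add: pulls_back_def)
  then show "zero_ext (topspace X) (f \<circ> K) \<in> C_inf X A"
    using assms(1) by (simp add: pulls_back_def zero_ext_compose[of F _ _ K H, OF F assms(3)])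
qed

text \<open>
  In product charts the slice at \<open>a\<close> is precomposition with the affine embedding
  \<open>z \<mapsto> (\<phi> a, 0) + (0, z)\<close>.
\<close>

lemma smooth_map_slice:
  fixes A :: "('a, 'b::real_normed_vector) chart set"
    and C :: "('c, 'd::real_normed_vector) chart set"
  assumes "smooth_manifold X A" "smooth_manifold Y C" "smooth_manifold Z B"
    "smooth_map (prod_topology X Y) (prod_atlas A C) Z B H" "a \<in> topspace X"
  shows "smooth_map Y C Z B (\<lambda>y. H (a, y))"
proof -
  have "continuous_map (prod_topology X Y) Z H" using assms(4) by (simp add: smooth_map_def)
  moreover have "continuous_map Y (prod_topology X Y) (\<lambda>y. (a, y))"
    using assms(5) by (simp add: continuous_map_pairedI)
  ultimately have cont: "continuous_map Y Z (\<lambda>y. H (a, y))"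
    using continuous_map_compose[of Y _ "\<lambda>y. (a, y)" Z H] by (simp add: o_def)
  obtain U \<phi> where U: "(U, \<phi>) \<in> A" "a \<in> U" using chart_cover[OF assms(1,5)] by blast
  have "smooth_on (\<theta> ` {y \<in> V. H (a, y) \<in> W}) (\<psi> \<circ> (\<lambda>y. H (a, y)) \<circ> inv_into V \<theta>)"
    if V: "(V, \<theta>) \<in> C" and W: "(W, \<psi>) \<in> B" for V \<theta> W \<psi>
  proof -
    let ?S = "map_prod \<phi> \<theta> ` {p \<in> U \<times> V. H p \<in> W}"
    let ?T = "\<theta> ` {y \<in> V. H (a, y) \<in> W}"
    let ?inv = "inv_into (U \<times> V) (map_prod \<phi> \<theta>)"
    have T: "open ?T" using open_chart_preimage[OF assms(2) V assms(3) W cont] .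
    have "(U \<times> V, map_prod \<phi> \<theta>) \<in> prod_atlas A C" using U V unfolding prod_atlas_def by blast
    then have sm: "smooth_on ?S (\<psi> \<circ> H \<circ> ?inv)"
      using assms(4) W unfolding smooth_map_def by fast
    have inj: "inj_on (map_prod \<phi> \<theta>) (U \<times> V)"
      using chart_inj[OF assms(1) U(1)] chart_inj[OF assms(2) V] by (rule map_prod_inj_on)
    have inv: "?inv (\<phi> a, \<theta> y) = (a, y)" if "y \<in> V" for y
      using inv_into_f_f[OF inj, of "(a, y)"] U that by simp
    have inS: "(\<phi> a, 0) + (0, z) \<in> ?S" if z: "z \<in> ?T" for z
    proof -
      obtain y where "y \<in> V" "H (a, y) \<in> W" "z = \<theta> y" using z by blast
      then show ?thesis using U(2) by (intro image_eqI[of _ _ "(a, y)"]) auto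
    qed
    have lin: "bounded_linear (\<lambda>z::'d. (0::'b, z))"
      by (intro bounded_linear_Pair bounded_linear_zero bounded_linear_ident)
    have "Ck_on n ?T (\<lambda>z. (\<psi> \<circ> H \<circ> ?inv) ((\<phi> a, 0) + (0, z)))" for n
      using Ck_on_affine[OF T lin inS] sm unfolding smooth_on_def by blast
    then show ?thesis
      unfolding smooth_on_def
      using Ck_on_cong[OF T, of "\<lambda>z. (\<psi> \<circ> H \<circ> ?inv) ((\<phi> a, 0) + (0, z))"
          "\<psi> \<circ> (\<lambda>y. H (a, y)) \<circ> inv_into V \<theta>"] inv chart_inj[OF assms(2) V]
      by fastforce
  qed
  with cont show ?thesis unfolding smooth_map_def by blast
qed


section \<open>Functoriality of tangent maps\<close>

lemma tangent_space_add:
  assumes "D \<in> tangent_space X A p" "E \<in> tangent_space X A p"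
  shows "(\<lambda>f. D f + E f) \<in> tangent_space X A p"
  using assms unfolding tangent_space_def by (simp add: algebra_simps)

lemma tangent_space_scale:
  assumes "D \<in> tangent_space X A p"
  shows "(\<lambda>f. c * D f) \<in> tangent_space X A p"
  using assms unfolding tangent_space_def by (simp add: algebra_simps)

text \<open>
  A tangent map is composition with the pullback \<open>f \<mapsto> f \<circ> F\<close>, which is a homomorphism of function
  algebras and turns evaluation at \<open>F p\<close> into evaluation at \<open>p\<close>; derivations go to derivations.
\<close>

lemma tangent_map_in_tangent_space:
  assumes "smooth_manifold Y B" "pulls_back X A Y B F" "p \<in> topspace X" "D \<in> tangent_space X A p"
  shows "tangent_map X Y B F D \<in> tangent_space Y B (F p)"
proof -
  let ?P = "\<lambda>f. zero_ext (topspace X) (f \<circ> F)"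
  have P: "?P f \<in> C_inf X A" if "f \<in> C_inf Y B" for f
    using assms(2) that unfolding pulls_back_def by blast
  have ev: "?P f p = f (F p)" for f using assms(3) by (simp add: zero_ext_def)
  have "?P (\<lambda>x. f x + g x) = (\<lambda>x. ?P f x + ?P g x)"
    "?P (\<lambda>x. f x * g x) = (\<lambda>x. ?P f x * ?P g x)"
    "?P (\<lambda>x. c * f x) = (\<lambda>x. c * ?P f x)" for f g and c :: real
    by (auto simp: zero_ext_def fun_eq_iff)
  then show ?thesis
    using assms(4) P ev C_inf_add[OF assms(1)] C_inf_mult[OF assms(1)] C_inf_scale[OF assms(1)]
    unfolding tangent_space_def tangent_map_def by simp
qed

lemma tangent_map_compose:
  assumes "F \<in> topspace X \<rightarrow> topspace Y" "pulls_back Y B Z C H"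
    "\<And>x. x \<in> topspace X \<Longrightarrow> K x = H (F x)"
  shows "tangent_map X Z C K D = tangent_map Y Z C H (tangent_map X Y B F D)"
  using assms(2)
  by (auto simp: tangent_map_def pulls_back_def fun_eq_iff zero_ext_compose[of F _ _ K H, OF assms(1,3)])


section \<open>Translations and the coadjoint action\<close>

context lie_group
begin

abbreviation smooth_self :: "('a \<Rightarrow> 'a) \<Rightarrow> bool" where
  "smooth_self \<equiv> pulls_back (gtop G) (atlas G) (gtop G) (atlas G)"

lemma smooth_self_left_mult:
  assumes "w \<in> carrier G"
  shows "smooth_self (left_mult G w)"
  using smooth_map_pulls_back[OF manifold manifold
      smooth_map_slice[OF manifold manifold manifold smooth_mult, of w]] assms
  by (simp add: topspace_gtop left_mult_def)

text \<open>
  Inversion exchanges the two kinds of translation, \<open>x w = (w\<^sup>-\<^sup>1 x\<^sup>-\<^sup>1)\<^sup>-\<^sup>1\<close>, so slices in one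
  variable suffice.
\<close>

lemma smooth_self_right_mult:
  assumes "w \<in> carrier G"
  shows "smooth_self (right_mult G w)"
proof -
  note I = smooth_map_pulls_back[OF manifold manifold smooth_inv]
  have "smooth_self (\<lambda>x. inv w \<otimes> inv x)"
    by (rule pulls_back_compose[OF I smooth_self_left_mult]) (simp_all add: assms left_mult_def)
  from pulls_back_compose[OF this I] show ?thesis
    using assms by (simp add: right_mult_def topspace_gtop inv_mult_group)
qed

lemma smooth_self_conj:
  assumes "g \<in> carrier G"
  shows "smooth_self (\<lambda>x. g \<otimes> x \<otimes> inv g)"
  by (rule pulls_back_compose[OF smooth_self_left_mult smooth_self_right_mult, of g "inv g"])
    (simp_all add: assms left_mult_def right_mult_def)

lemma lie_tangent_compose:
  assumes "smooth_self F" "smooth_self H" "\<And>x. x \<in> carrier G \<Longrightarrow> K x = H (F x)"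
  shows "lie_tangent G K \<eta> = lie_tangent G H (lie_tangent G F \<eta>)"
  unfolding lie_tangent_def
  by (rule tangent_map_compose) (use assms topspace_gtop in \<open>auto simp: pulls_back_def\<close>)

lemma lie_tangent_right_mult_in:
  assumes "w \<in> carrier G" "\<eta> \<in> lie_algebra G"
  shows "lie_tangent G (right_mult G w) \<eta> \<in> tangent_space (gtop G) (atlas G) w"
  using tangent_map_in_tangent_space[OF manifold smooth_self_right_mult[OF assms(1)], of \<one> \<eta>] assms
  by (simp add: lie_tangent_def lie_algebra_def topspace_gtop right_mult_def)

lemma Ad_in_lie_algebra:
  assumes "g \<in> carrier G" "\<eta> \<in> lie_algebra G"
  shows "Ad G g \<eta> \<in> lie_algebra G"
  using tangent_map_in_tangent_space[OF manifold smooth_self_conj[OF assms(1)], of \<one> \<eta>] assms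
  by (simp add: Ad_def lie_tangent_def lie_algebra_def topspace_gtop)

lemma Ad_mult:
  assumes "g \<in> carrier G" "h \<in> carrier G"
  shows "Ad G (g \<otimes> h) \<eta> = Ad G g (Ad G h \<eta>)"
  unfolding Ad_def
  by (rule lie_tangent_compose[OF smooth_self_conj smooth_self_conj])
    (simp_all add: assms m_assoc inv_mult_group)

lemma Ad_dual_mult:
  assumes "g \<in> carrier G" "h \<in> carrier G"
  shows "Ad_dual G (g \<otimes> h) \<mu> = Ad_dual G h (Ad_dual G g \<mu>)"
  by (simp add: Ad_dual_def Ad_mult Ad_in_lie_algebra assms cong: if_cong)

text \<open>
  The identity \<open>w x = (w x w\<^sup>-\<^sup>1) w\<close> on the level of tangent maps.
\<close>

lemma Ad_dual_right_pull:
  assumes "w \<in> carrier G"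
  shows "Ad_dual G w (right_pull G w \<alpha>) = left_pull G w \<alpha>"
proof -
  have "lie_tangent G (left_mult G w) \<eta> = lie_tangent G (right_mult G w) (Ad G w \<eta>)" for \<eta>
    unfolding Ad_def
    by (rule lie_tangent_compose[OF smooth_self_conj smooth_self_right_mult])
      (simp_all add: assms left_mult_def right_mult_def m_assoc)
  then show ?thesis
    using Ad_in_lie_algebra[OF assms] by (auto simp: Ad_dual_def right_pull_def left_pull_def)
qed

text \<open>
  The tangent map acts on derivations by precomposition and a differential by evaluation, both linear
  for pointwise operations.  The base point has to be tracked because a differential vanishes by
  convention outside its own tangent space.
\<close>

lemma right_pull_in_lie_dual:
  assumes "w \<in> carrier G"
  shows "right_pull G w (lie_d G l w) \<in> lie_dual G"
proof -
  let ?T = "lie_tangent G (right_mult G w)"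
  have "?T (\<lambda>f. \<eta> f + \<xi> f) = (\<lambda>f. ?T \<eta> f + ?T \<xi> f)" "?T (\<lambda>f. c * \<eta> f) = (\<lambda>f. c * ?T \<eta> f)"
    for \<eta> \<xi> c by (auto simp: lie_tangent_def tangent_map_def)
  then show ?thesis
    using lie_tangent_right_mult_in[OF assms]
    by (auto simp: lie_dual_def right_pull_def lie_d_def differential_def lie_algebra_def
        tangent_space_add tangent_space_scale)
qed

lemma Ad_dual_in_coadjoint_orbit:
  assumes "g \<in> carrier G"
  shows "Ad_dual G g \<mu> \<in> coadjoint_orbit G \<mu>"
  unfolding coadjoint_orbit_def using assms by (auto intro!: exI[of _ "inv g"])

end


theorem mainTheorem2:
  fixes G :: "('a, 'b::real_normed_vector, 'm) lie_structure_scheme"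
    and l\<^sub>d :: "'a \<Rightarrow> real" and \<phi>\<^sub>d :: "'a \<Rightarrow> 'a"
    and N :: nat and w :: "nat \<Rightarrow> 'a" and M :: "nat \<Rightarrow> 'a covec"
  assumes "lie_group G"
    and "smooth_real (gtop G) (atlas G) l\<^sub>d"
    and "\<phi>\<^sub>d \<in> carrier G \<rightarrow> carrier G"
    and "\<And>k. k < N \<Longrightarrow> w k \<in> carrier G"
    and "\<And>k. k < N \<Longrightarrow> M k = right_pull G (w k) (lie_d G l\<^sub>d (w k))"
  shows "(\<forall>k<N. M k \<in> lie_dual G) \<and>
    ((\<forall>k. k + 1 < N \<longrightarrow>
        (\<lambda>\<eta>. 0) = (\<lambda>\<eta>. right_pull G (w (k + 1)) (lie_d G l\<^sub>d (w (k + 1))) \<eta>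
                     - Ad_dual G (\<phi>\<^sub>d (w k)) (left_pull G (w k) (lie_d G l\<^sub>d (w k))) \<eta>))
     \<longleftrightarrow>
     (\<forall>k. k + 1 < N \<longrightarrow> M (k + 1) = Ad_dual G (w k \<otimes>\<^bsub>G\<^esub> \<phi>\<^sub>d (w k)) (M k))) \<and>
    ((\<forall>k. k + 1 < N \<longrightarrow> M (k + 1) = Ad_dual G (w k \<otimes>\<^bsub>G\<^esub> \<phi>\<^sub>d (w k)) (M k))
     \<longrightarrow> (\<forall>k. k + 1 < N \<longrightarrow> M (k + 1) \<in> coadjoint_orbit G (M k)))"
proof -
  interpret lie_group G by fact
  have \<phi>: "\<phi>\<^sub>d (w k) \<in> carrier G" if "k < N" for k
    using assms(3,4) that by blast
  have dual: "M k \<in> lie_dual G" if "k < N" for k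
    using right_pull_in_lie_dual assms(4,5) that by simp
  have momentum: "Ad_dual G (w k \<otimes>\<^bsub>G\<^esub> \<phi>\<^sub>d (w k)) (M k) =
      Ad_dual G (\<phi>\<^sub>d (w k)) (left_pull G (w k) (lie_d G l\<^sub>d (w k)))" if "k < N" for k
    using that by (simp add: Ad_dual_mult Ad_dual_right_pull assms(4,5) \<phi>)
  have "(\<lambda>\<eta>. 0) = (\<lambda>\<eta>. right_pull G (w (k + 1)) (lie_d G l\<^sub>d (w (k + 1))) \<eta>
                     - Ad_dual G (\<phi>\<^sub>d (w k)) (left_pull G (w k) (lie_d G l\<^sub>d (w k))) \<eta>)
     \<longleftrightarrow> M (k + 1) = Ad_dual G (w k \<otimes>\<^bsub>G\<^esub> \<phi>\<^sub>d (w k)) (M k)" if "k + 1 < N" for k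
    using momentum[of k] assms(5)[of "k + 1"] that by (auto simp: fun_eq_iff)
  moreover have "Ad_dual G (w k \<otimes>\<^bsub>G\<^esub> \<phi>\<^sub>d (w k)) (M k) \<in> coadjoint_orbit G (M k)"
    if "k < N" for k
    using Ad_dual_in_coadjoint_orbit assms(4) \<phi> that by simp
  ultimately show ?thesis using dual by auto
qed

end
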